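(* Let $\tau>0$ and let $t_0=2\pi k$ with $k\in\mathbb{Z}$. For every $\ell\in\mathbb{N}_0$ the level-$\ell$ coefficients of the two diagonal traces and of either mixed trace satisfy $$\langle\widehat u_\ell,\pi_\ell^*(g_{t_0})\widehat u_\ell\rangle=1,\qquad \langle\widehat w_\ell(\tau),\pi_\ell^*(g_{t_0})\widehat w_\ell(\tau)\rangle=1,$$ $$\mathrm{Tr}_{V_\ell^*}\bigl(P_{h,\ell}\,\pi_\ell^*(g_{t_0})\,P_{\tau,\ell}\bigr)=\mathrm{Tr}_{V_\ell^*}\bigl(P_{\tau,\ell}\,\pi_\ell^*(g_{t_0})\,P_{h,\ell}\bigr)=s_\ell(\tau).$$ Moreover, $$s_\ell(\tau)=C_{\mathrm{BF}}(\tau)^2\,r(\tau)^{2\ell}\bigl(1+O_\tau(\ell^{-1})\bigr),\qquad \ell\to\infty,$$ where $$C_{\mathrm{BF}}(\tau)=(2\sinh2\tau)^{1/4}e^{-\tau/2},\qquad r(\tau)=\frac{1-e^{-2\tau}}2 .$$ Thus the two diagonal coefficients are identically one, while the mixed coefficient satisfies $r(\tau)^{-2\ell}s_\ell(\tau)\to C_{\mathrm{BF}}(\tau)^2$ as $\ell\to\infty$.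
   Context: $E_2\in\mathfrak{so}(3)$ is the infinitesimal rotation with $E_2e_1=-e_3$, $E_2e_2=0$, $E_2e_3=e_1$, and $g_t=\exp(-tE_2)\in\mathrm{SO}(3)$. $V_\ell$ is the irreducible unitary $\mathrm{SO}(3)$ representation of dimension $2\ell+1$ and $\pi_\ell^*$ is the contragredient representation on $V_\ell^*$. Via a fixed equivariant unitary identification, $V_\ell^*\simeq V_\ell\simeq\mathrm{Sym}^{2\ell}\mathbb{C}^2$, the homogeneous polynomials of degree $2\ell$ in $(z_0,z_1)$, with the invariant inner product for which monomials are orthogonal and $\|z_0^{2\ell-k}z_1^k\|^2=\binom{2\ell}{k}^{-1}$. Put $u_\ell=z_0^{2\ell}$, $w_\ell(\tau)=(z_0^2+z_1^2+2\coth\tau\,z_0z_1)^\ell$, $\widehat v=v/\|v\|$. $P_{h,\ell}$ and $P_{\tau,\ell}$ are the orthogonal rank-one projectors of $V_\ell^*$ onto $\mathbb{C}\widehat u_\ell$ and $\mathbb{C}\widehat w_\ell(\tau)$, and $s_\ell(\tau)=|\langle\widehat w_\ell(\tau),\widehat u_\ell\rangle|^2$. *)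

theory Defs
  imports
    "Jordan_Normal_Form.Schur_Decomposition"
    "Jordan_Normal_Form.VS_Connect"
    "HOL-Library.Landau_Symbols"
begin

subsection \<open>The groups SO(3) and SU(2)\<close>

definition SO3 :: "real mat set" where
  "SO3 = {g \<in> carrier_mat 3 3. transpose_mat g * g = 1\<^sub>m 3 \<and> det g = 1}"

definition SU2 :: "complex mat set" where
  "SU2 = {A \<in> carrier_mat 2 2. mat_adjoint A * A = 1\<^sub>m 2 \<and> det A = 1}"

definition mat_tendsto :: "(nat \<Rightarrow> 'a::topological_space mat) \<Rightarrow> 'a mat \<Rightarrow> bool" where
  "mat_tendsto X L \<longleftrightarrow>
     (\<forall>i<dim_row L. \<forall>j<dim_col L. (\<lambda>m. X m $$ (i, j)) \<longlonglongrightarrow> L $$ (i, j))"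

text \<open>Matrices of a fixed size form a metrizable space, so continuity may be tested on sequences.\<close>

definition mat_continuous_on ::
  "'a::topological_space mat set \<Rightarrow> ('a mat \<Rightarrow> 'b::topological_space mat) \<Rightarrow> bool" where
  "mat_continuous_on S F \<longleftrightarrow>
     (\<forall>X L. (\<forall>m. X m \<in> S) \<and> L \<in> S \<and> mat_tendsto X L \<longrightarrow> mat_tendsto (\<lambda>m. F (X m)) (F L))"

text \<open>A continuous surjective homomorphism from SU(2) to SO(3) automatically has kernel
  \<open>{1, -1}\<close>. Two such maps differ by a rotation of the axes of \<open>\<real>\<^sup>3\<close>.\<close>

definition double_cover :: "(complex mat \<Rightarrow> real mat) \<Rightarrow> bool" where
  "double_cover \<kappa> \<longleftrightarrow>
     \<kappa> ` SU2 = SO3 \<and> (\<forall>A\<in>SU2. \<forall>B\<in>SU2. \<kappa> (A * B) = \<kappa> A * \<kappa> B) \<and> mat_continuous_on SU2 \<kappa>"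

definition mat_exp :: "real mat \<Rightarrow> real mat" where
  "mat_exp A = mat (dim_row A) (dim_row A) (\<lambda>(i, j). \<Sum>m. (A ^\<^sub>m m) $$ (i, j) / fact m)"

definition E2 :: "real mat" where
  "E2 = mat_of_rows_list 3 [[0, 0, 1], [0, 0, 0], [-1, 0, 0]]"

definition g_rot :: "real \<Rightarrow> real mat" where
  "g_rot t = mat_exp ((- t) \<cdot>\<^sub>m E2)"


subsection \<open>Unitary representations of SO(3) and their contragredients\<close>

text \<open>An \<open>n\<close>-dimensional unitary representation is written in an orthonormal basis, so that the
  representation space is \<open>carrier_vec n\<close> with its standard inner product. Inner products are
  taken linear in the second argument, whereas \<open>\<bullet>c\<close> is linear in the first.\<close>

definition hinner :: "complex vec \<Rightarrow> complex vec \<Rightarrow> complex" where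
  "hinner x y = y \<bullet>c x"

definition unitary_rep_SO3 :: "nat \<Rightarrow> (real mat \<Rightarrow> complex mat) \<Rightarrow> bool" where
  "unitary_rep_SO3 n \<pi> \<longleftrightarrow>
     (\<forall>g\<in>SO3. \<pi> g \<in> carrier_mat n n \<and> mat_adjoint (\<pi> g) * \<pi> g = 1\<^sub>m n) \<and>
     (\<forall>g\<in>SO3. \<forall>h\<in>SO3. \<pi> (g * h) = \<pi> g * \<pi> h) \<and>
     mat_continuous_on SO3 \<pi>"

definition irreducible_rep_SO3 :: "nat \<Rightarrow> (real mat \<Rightarrow> complex mat) \<Rightarrow> bool" where
  "irreducible_rep_SO3 n \<pi> \<longleftrightarrow> n > 0 \<and>
     (\<forall>W. VectorSpace.subspace class_ring W (module_vec TYPE(complex) n) \<and>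
          (\<forall>g\<in>SO3. \<forall>v\<in>W. \<pi> g *\<^sub>v v \<in> W) \<longrightarrow> W = {0\<^sub>v n} \<or> W = carrier_vec n)"

text \<open>The dual space is written in the dual basis: \<open>\<phi> \<in> carrier_vec n\<close> stands for the functional
  \<open>v \<mapsto> \<phi> \<bullet> v\<close> (bilinear pairing), and the dual inner product is again the standard one. The
  contragredient action \<open>(\<pi>\<^sup>* g \<phi>) v = \<phi> (\<pi> (g\<^sup>-\<^sup>1) v)\<close> is then given by the transpose of
  \<open>\<pi> (g\<^sup>-\<^sup>1)\<close>, where \<open>g\<^sup>-\<^sup>1\<close> is the transpose of \<open>g\<close>.\<close>

definition contragredient :: "(real mat \<Rightarrow> complex mat) \<Rightarrow> real mat \<Rightarrow> complex mat" where
  "contragredient \<pi> g = transpose_mat (\<pi> (transpose_mat g))"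

definition mat_trace :: "complex mat \<Rightarrow> complex" where
  "mat_trace A = (\<Sum>i<dim_row A. A $$ (i, i))"

text \<open>The matrix \<open>v v\<^sup>* / \<langle>v, v\<rangle>\<close> of the orthogonal projector onto the line spanned by \<open>v \<noteq> 0\<close>.\<close>

definition line_projector :: "complex vec \<Rightarrow> complex mat" where
  "line_projector v =
     mat (dim_vec v) (dim_vec v) (\<lambda>(i, j). v $ i * cnj (v $ j) / hinner v v)"


subsection \<open>Binary forms\<close>

text \<open>\<open>\<complex>[z\<^sub>0, z\<^sub>1]\<close> is realised as \<open>\<complex>[z\<^sub>0][z\<^sub>1]\<close>: the outer variable is \<open>z\<^sub>1\<close>.\<close>

definition Cst :: "complex \<Rightarrow> complex poly poly" where
  "Cst c = [:[:c:]:]"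

definition Z0 :: "complex poly poly" where
  "Z0 = [:[:0, 1:]:]"

definition Z1 :: "complex poly poly" where
  "Z1 = [:0, 1:]"

definition bcoeff :: "complex poly poly \<Rightarrow> nat \<Rightarrow> nat \<Rightarrow> complex" where
  "bcoeff p i j = coeff (coeff p j) i"

definition Sym :: "nat \<Rightarrow> complex poly poly set" where
  "Sym n = {p. \<forall>i j. i + j \<noteq> n \<longrightarrow> bcoeff p i j = 0}"

text \<open>Monomials are orthogonal and \<open>z\<^sub>0\<^bsup>n-k\<^esup> z\<^sub>1\<^bsup>k\<^esup>\<close> has squared norm \<open>1 / (n choose k)\<close>.\<close>

definition sym_inner :: "nat \<Rightarrow> complex poly poly \<Rightarrow> complex poly poly \<Rightarrow> complex" where
  "sym_inner n p q =
     (\<Sum>k\<le>n. cnj (bcoeff p (n - k) k) * bcoeff q (n - k) k / of_nat (n choose k))"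

definition sym_norm :: "nat \<Rightarrow> complex poly poly \<Rightarrow> real" where
  "sym_norm n p = sqrt (Re (sym_inner n p p))"

definition sym_hat :: "nat \<Rightarrow> complex poly poly \<Rightarrow> complex poly poly" where
  "sym_hat n p = Cst (complex_of_real (1 / sym_norm n p)) * p"

text \<open>The action on forms of degree \<open>n\<close> induced by the natural action on \<open>\<complex>\<^sup>2\<close> with basis
  \<open>z\<^sub>0, z\<^sub>1\<close>, that is, by the algebra automorphism \<open>z\<^sub>j \<mapsto> A\<^sub>0\<^sub>j z\<^sub>0 + A\<^sub>1\<^sub>j z\<^sub>1\<close>.\<close>

definition sym_action :: "nat \<Rightarrow> complex mat \<Rightarrow> complex poly poly \<Rightarrow> complex poly poly" where
  "sym_action n A p =
     (\<Sum>k\<le>n. Cst (bcoeff p (n - k) k) *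
        (Cst (A $$ (0, 0)) * Z0 + Cst (A $$ (1, 0)) * Z1) ^ (n - k) *
        (Cst (A $$ (0, 1)) * Z0 + Cst (A $$ (1, 1)) * Z1) ^ k)"

text \<open>A unitary identification of the dual space of a \<open>(2 l + 1)\<close>-dimensional representation
  \<open>\<pi>\<close> with the forms of degree \<open>2 l\<close>. On the latter SO(3) acts through the double cover
  \<open>\<kappa>\<close>, so equivariance is expressed by elements of SU(2).\<close>

definition equivariant_unitary_identification ::
  "(complex mat \<Rightarrow> real mat) \<Rightarrow> nat \<Rightarrow> (real mat \<Rightarrow> complex mat) \<Rightarrow>
   (complex vec \<Rightarrow> complex poly poly) \<Rightarrow> bool" where
  "equivariant_unitary_identification \<kappa> l \<pi> \<Phi> \<longleftrightarrow>
     bij_betw \<Phi> (carrier_vec (2 * l + 1)) (Sym (2 * l)) \<and>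
     (\<forall>x\<in>carrier_vec (2 * l + 1). \<forall>y\<in>carrier_vec (2 * l + 1). \<Phi> (x + y) = \<Phi> x + \<Phi> y) \<and>
     (\<forall>c. \<forall>x\<in>carrier_vec (2 * l + 1). \<Phi> (c \<cdot>\<^sub>v x) = Cst c * \<Phi> x) \<and>
     (\<forall>x\<in>carrier_vec (2 * l + 1). \<forall>y\<in>carrier_vec (2 * l + 1).
        sym_inner (2 * l) (\<Phi> x) (\<Phi> y) = hinner x y) \<and>
     (\<forall>A\<in>SU2. \<forall>x\<in>carrier_vec (2 * l + 1).
        \<Phi> (contragredient \<pi> (\<kappa> A) *\<^sub>v x) = sym_action (2 * l) A (\<Phi> x))"

definition to_dual :: "nat \<Rightarrow> (complex vec \<Rightarrow> complex poly poly) \<Rightarrow> complex poly poly \<Rightarrow> complex vec" where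
  "to_dual l \<Phi> p = the_inv_into (carrier_vec (2 * l + 1)) \<Phi> p"


subsection \<open>The two vectors and their overlap\<close>

definition u_form :: "nat \<Rightarrow> complex poly poly" where
  "u_form l = Z0 ^ (2 * l)"

definition w_form :: "nat \<Rightarrow> real \<Rightarrow> complex poly poly" where
  "w_form l \<tau> = (Z0\<^sup>2 + Z1\<^sup>2 + Cst (complex_of_real (2 * (cosh \<tau> / sinh \<tau>))) * Z0 * Z1) ^ l"

definition u_hat :: "nat \<Rightarrow> complex poly poly" where
  "u_hat l = sym_hat (2 * l) (u_form l)"

definition w_hat :: "nat \<Rightarrow> real \<Rightarrow> complex poly poly" where
  "w_hat l \<tau> = sym_hat (2 * l) (w_form l \<tau>)"

definition overlap :: "nat \<Rightarrow> real \<Rightarrow> real" where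
  "overlap l \<tau> = (cmod (sym_inner (2 * l) (w_hat l \<tau>) (u_hat l)))\<^sup>2"

definition P_h :: "nat \<Rightarrow> (complex vec \<Rightarrow> complex poly poly) \<Rightarrow> complex mat" where
  "P_h l \<Phi> = line_projector (to_dual l \<Phi> (u_hat l))"

definition P_tau :: "nat \<Rightarrow> real \<Rightarrow> (complex vec \<Rightarrow> complex poly poly) \<Rightarrow> complex mat" where
  "P_tau l \<tau> \<Phi> = line_projector (to_dual l \<Phi> (w_hat l \<tau>))"

definition C_BF :: "real \<Rightarrow> real" where
  "C_BF \<tau> = (2 * sinh (2 * \<tau>)) powr (1 / 4) * exp (- \<tau> / 2)"

definition r_BF :: "real \<Rightarrow> real" where
  "r_BF \<tau> = (1 - exp (- 2 * \<tau>)) / 2"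

end

theory Submission
  imports "HOL-Analysis.Generalised_Binomial_Theorem" Defs
begin

text \<open>Since \<open>exp (- 2 \<pi> k E\<^sub>2) = 1\<close>, all traces reduce to inner products of unit vectors, and
  \<open>s\<^sub>\<ell> = 1 / \<parallel>w\<^sub>\<ell>\<parallel>\<^sup>2\<close> because \<open>z\<^sub>0\<^bsup>2\<ell>\<^esup>\<close> has coefficient \<open>1\<close> in \<open>w\<^sub>\<ell>\<close>. An element of SU(2) rotating
  by 45 degrees turns \<open>w\<^sub>\<ell>\<close> into \<open>(a z\<^sub>0\<^sup>2 + b z\<^sub>1\<^sup>2)\<^bsup>\<ell>\<^esup>\<close> with \<open>a = 1 + coth \<tau> = 1 / r\<close> and
  \<open>b = 1 - coth \<tau> = - exp (- 2 \<tau>) / r\<close>. With \<open>c\<^sub>n = (2n choose n) / 4\<^bsup>n\<^esup>\<close> and \<open>q = exp (- 4 \<tau>)\<close> this gives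
  \<open>r\<^bsup>2\<ell>\<^esup> \<parallel>w\<^sub>\<ell>\<parallel>\<^sup>2 = \<Sum>k\<le>\<ell>. c\<^sub>k c\<^bsub>\<ell>-k\<^esub> / c\<^sub>\<ell> q\<^bsup>k\<^esup>\<close>. As \<open>c\<^bsub>\<ell>-k\<^esub> / c\<^sub>\<ell> = 1 + O(k\<^sup>2 / \<ell>)\<close>, the sum differs by
  \<open>O(1 / \<ell>)\<close> from \<open>\<Sum>k. c\<^sub>k q\<^bsup>k\<^esup> = (1 - q)\<^bsup>-1/2\<^esup> = 1 / C\<^sub>B\<^sub>F\<^sup>2\<close>.\<close>

subsection \<open>Normalised central binomial coefficients\<close>

definition cbin :: "nat \<Rightarrow> real" where
  "cbin n = real (2 * n choose n) / 4 ^ n"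

lemma cbin_0 [simp]: "cbin 0 = 1"
  by (simp add: cbin_def)

lemma cbin_pos: "cbin n > 0"
  by (simp add: cbin_def)

lemma cbin_fact: "cbin n = fact (2 * n) / (fact n ^ 2 * 4 ^ n)"
  using binomial_fact[of n "2 * n", where 'a = real]
  by (simp add: cbin_def power2_eq_square mult_2)

text \<open>The ratio (2n+1)/(2n+2) is kept in product form: comparing 2n+2 with 2n+1 gives
  \<open>cbin_antimono\<close>, comparing it with 2n+3 gives
  \<open>cbin_scaled_mono\<close>.\<close>

lemma cbin_Suc: "cbin (Suc n) * (2 * real n + 2) = cbin n * (2 * real n + 1)"
proof -
  have "(fact (2 * Suc n) :: real) = (2 * real n + 2) * (2 * real n + 1) * fact (2 * n)"
    by (simp add: add_ac)
  moreover have "(fact (Suc n) :: real) ^ 2 * 4 ^ Suc n = (2 * real n + 2)\<^sup>2 * (fact n ^ 2 * 4 ^ n)"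
    by (simp add: power2_eq_square algebra_simps)
  ultimately have "cbin (Suc n) =
      ((2 * real n + 2) * (2 * real n + 1) * fact (2 * n)) / ((2 * real n + 2)\<^sup>2 * (fact n ^ 2 * 4 ^ n))"
    by (simp only: cbin_fact)
  also have "\<dots> = (2 * real n + 1) / (2 * real n + 2) * cbin n"
    unfolding cbin_fact power2_eq_square[of "2 * real n + 2"]
    by (simp only: times_divide_times_eq mult.assoc) simp
  finally show ?thesis
    by (simp add: add_pos_nonneg less_imp_neq[symmetric])
qed

lemma cbin_antimono: "m \<le> n \<Longrightarrow> cbin n \<le> cbin m"
proof (induction rule: dec_induct)
  case (step n)
  have "cbin (Suc n) * (2 * real n + 2) \<le> cbin n * (2 * real n + 2)"
    unfolding cbin_Suc using cbin_pos[of n] by (intro mult_left_mono) auto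
  hence "cbin (Suc n) \<le> cbin n" by (rule mult_right_le_imp_le) simp
  with step show ?case by simp
qed simp

lemma cbin_le_1: "cbin n \<le> 1"
  using cbin_antimono[of 0 n] by simp

lemma cbin_scaled_mono: "m \<le> n \<Longrightarrow> cbin m * (2 * real m + 1) \<le> cbin n * (2 * real n + 1)"
proof (induction rule: dec_induct)
  case (step n)
  have "cbin (Suc n) * (2 * real n + 2) \<le> cbin (Suc n) * (2 * real (Suc n) + 1)"
    using cbin_pos[of "Suc n"] by (intro mult_left_mono) auto
  hence "cbin n * (2 * real n + 1) \<le> cbin (Suc n) * (2 * real (Suc n) + 1)"
    by (simp only: cbin_Suc)
  with step show ?case by simp
qed simp

text \<open>The two monotonicity lemmas squeeze the quotient between 1 and (2l+1)/(2m+1), where m =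
  l - k. The excess 2k/(2m+1) is weakened so that l occurs only in the denominator and k only in the
  numerator, ready for summation over k.\<close>

lemma cbin_quotient_bound:
  assumes "k \<le> l"
  shows "\<bar>cbin (l - k) / cbin l - 1\<bar> \<le> 2 * real k * (2 * real k + 1) / (2 * real l + 1)"
proof -
  define m where "m = l - k"
  have l: "l = k + m" using assms by (simp add: m_def)
  have "1 \<le> cbin m / cbin l"
    using cbin_antimono[of m l] cbin_pos[of l] by (simp add: l)
  moreover have "cbin m / cbin l \<le> (2 * real l + 1) / (2 * real m + 1)"
    using cbin_scaled_mono[of m l] cbin_pos[of l] by (simp add: l divide_simps mult_ac)
  moreover have "(2 * real l + 1) / (2 * real m + 1) - 1 = 2 * real k / (2 * real m + 1)"
    by (simp add: l field_simps)
  moreover have "2 * real k / (2 * real m + 1) \<le> 2 * real k * (2 * real k + 1) / (2 * real l + 1)"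
  proof -
    \<comment> \<open>Holds because (2k+1)(2m+1) = (2l+1) + 4km.\<close>
    have "1 / (2 * real m + 1) \<le> (2 * real k + 1) / (2 * real l + 1)"
      by (simp add: l field_simps)
    from mult_left_mono[OF this, of "2 * real k"] show ?thesis by simp
  qed
  ultimately show ?thesis by (simp add: m_def)
qed

text \<open>Both sides start at 1 and obey the recurrence of \<open>cbin_Suc\<close>. The right side
  makes the generating function a binomial series with exponent -1/2.\<close>

lemma cbin_gbinomial: "cbin n = (- 1) ^ n * ((- 1 / 2) gchoose n)"
proof (induction n)
  case (Suc n)
  define G where "G k = (- 1 / 2 :: real) gchoose k" for k
  have "(real n + 1) * G (Suc n) = (- 1 / 2 - real n) * G n"
    using gbinomial_absorb_comp[of "- 1 / 2 :: real" n] gbinomial_absorption[of n "- 1 / 2 :: real"]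
    by (simp add: G_def add.commute)
  hence G: "G (Suc n) * (2 * real n + 2) = - (G n * (2 * real n + 1))"
    by (simp add: algebra_simps)
  have "cbin (Suc n) * (2 * real n + 2) = (- 1) ^ n * (G n * (2 * real n + 1))"
    by (simp add: cbin_Suc Suc.IH G_def)
  also have "\<dots> = (- 1) ^ Suc n * (G (Suc n) * (2 * real n + 2))"
    by (simp add: G)
  finally have "cbin (Suc n) * (2 * real n + 2) = (- 1) ^ Suc n * G (Suc n) * (2 * real n + 2)"
    by (simp only: mult.assoc)
  moreover have "2 * real n + 2 > 0" by simp
  ultimately show ?case unfolding G_def[symmetric] by (metis less_irrefl mult_right_cancel)
qed simp

lemma cbin_sums:
  assumes "\<bar>q\<bar> < 1"
  shows "(\<lambda>n. cbin n * q ^ n) sums (1 / sqrt (1 - q))"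
proof -
  have "(\<lambda>n. ((-1/2) gchoose n) * (- q) ^ n) sums (1 + (- q)) powr (-1/2)"
    using assms by (intro gen_binomial_real) simp
  moreover have "((-1/2) gchoose n) * (- q) ^ n = cbin n * q ^ n" for n
    by (simp add: cbin_gbinomial power_minus[of q])
  moreover have "(1 + (- q)) powr (-1/2) = 1 / sqrt (1 - q)"
    using assms by (simp add: powr_minus_divide powr_half_sqrt)
  ultimately show ?thesis by simp
qed

text \<open>The weight is the numerator in \<open>cbin_quotient_bound\<close>. Differentiating the
  geometric series twice gives the coefficients (k+1)(k+2), and four times these dominate the
  weight.\<close>

lemma summable_quadratic_geometric:
  fixes q :: real
  assumes "0 \<le> q" "q < 1"
  shows "summable (\<lambda>k. 2 * real k * (2 * real k + 1) * q ^ k)"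
proof (rule summable_comparison_test')
  have 1: "summable (\<lambda>k. diffs (\<lambda>_. 1) k * x ^ k)" if "norm x < 1" for x :: real
    by (rule termdiff_converges[OF that]) (simp add: summable_geometric)
  have "summable (\<lambda>k. diffs (diffs (\<lambda>_. 1)) k * q ^ k)"
    by (rule termdiff_converges[of q 1]) (use assms 1 in auto)
  thus "summable (\<lambda>k. 4 * (diffs (diffs (\<lambda>_. 1)) k * q ^ k))"
    by (rule summable_mult)
  show "norm (2 * real k * (2 * real k + 1) * q ^ k) \<le> 4 * (diffs (diffs (\<lambda>_. 1)) k * q ^ k)"
    for k
  proof -
    have "2 * real k * (2 * real k + 1) * q ^ k \<le> 4 * ((real k + 1) * (real k + 2)) * q ^ k"
      using assms by (intro mult_right_mono) (auto simp: algebra_simps)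
    thus ?thesis using assms by (simp add: diffs_def abs_mult mult_ac add_ac)
  qed
qed

text \<open>Termwise comparison with the series of \<open>cbin_sums\<close>: the k-th terms differ
  by at most \<open>h k / l\<close> with \<open>h\<close> summable, which gives the rate 1/l and not
  only convergence.\<close>

lemma cbin_convolution_asymptotics:
  fixes q :: real
  assumes "0 \<le> q" "q < 1"
  shows "(\<lambda>l. (\<Sum>k\<le>l. cbin k * cbin (l - k) / cbin l * q ^ k) - 1 / sqrt (1 - q))
    \<in> O(\<lambda>l. 1 / real l)"
proof -
  define h where "h k = 2 * real k * (2 * real k + 1) * q ^ k" for k
  have h: "summable h" unfolding h_def using assms by (intro summable_quadratic_geometric) auto
  \<comment> \<open>Extension by zero beyond k = l turns the finite sum into a series over all
    k.\<close>
  define f where "f l k = (if k \<le> l then cbin (l - k) / cbin l else 0)" for l k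
  define N where "N l = (\<Sum>k\<le>l. cbin k * cbin (l - k) / cbin l * q ^ k)" for l
  have bound: "norm (N l - 1 / sqrt (1 - q)) \<le> suminf h * norm (1 / real l)" if "l > 0" for l
  proof -
    have "(\<lambda>k. f l k * (cbin k * q ^ k)) sums (\<Sum>k\<le>l. f l k * (cbin k * q ^ k))"
      by (intro sums_finite) (auto simp: f_def)
    also have "(\<Sum>k\<le>l. f l k * (cbin k * q ^ k)) = N l"
      unfolding N_def f_def by (intro sum.cong) auto
    finally have "(\<lambda>k. f l k * (cbin k * q ^ k) - cbin k * q ^ k) sums (N l - 1 / sqrt (1 - q))"
      using assms by (intro sums_diff cbin_sums) auto
    hence s: "(\<lambda>k. (f l k - 1) * (cbin k * q ^ k)) sums (N l - 1 / sqrt (1 - q))"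
      by (simp add: algebra_simps)
    have le: "norm ((f l k - 1) * (cbin k * q ^ k)) \<le> h k * (1 / real l)" for k
    proof -
      have "\<bar>f l k - 1\<bar> \<le> 2 * real k * (2 * real k + 1) / (2 * real l + 1)"
      proof (cases "k \<le> l")
        case True
        with cbin_quotient_bound[OF True] show ?thesis by (simp add: f_def)
      next
        case False
        \<comment> \<open>Here \<open>f l k\<close> is 0, so the deviation is exactly 1; the bound
          exceeds 1 for k > l, and the tail of the series is covered by the same estimate.\<close>
        hence "1 * (2 * real l + 1) \<le> 2 * real k * (2 * real k + 1)"
          by (intro mult_mono) auto
        thus ?thesis using False by (simp add: f_def)
      qed
      also have "\<dots> \<le> 2 * real k * (2 * real k + 1) / real l"
        using that by (intro divide_left_mono) auto
      finally have 1: "\<bar>f l k - 1\<bar> \<le> 2 * real k * (2 * real k + 1) / real l" .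
      have 2: "\<bar>cbin k * q ^ k\<bar> \<le> q ^ k"
        using cbin_le_1[of k] cbin_pos[of k] assms by (simp add: abs_mult mult_left_le_one_le)
      have "\<bar>f l k - 1\<bar> * \<bar>cbin k * q ^ k\<bar> \<le> 2 * real k * (2 * real k + 1) / real l * q ^ k"
        by (intro mult_mono 1 2) auto
      thus ?thesis by (simp add: h_def abs_mult)
    qed
    have "norm (N l - 1 / sqrt (1 - q)) \<le> (\<Sum>k. h k * (1 / real l))"
      unfolding sums_unique[OF s]
      by (rule norm_suminf_le[OF le summable_mult2[OF h]])
    also have "\<dots> = suminf h * (1 / real l)" by (rule suminf_mult2[OF h, symmetric])
    finally show ?thesis by simp
  qed
  show ?thesis unfolding N_def[symmetric]
    by (rule bigoI[of _ "suminf h"], rule eventually_mono[OF eventually_gt_at_top[of 0]], rule bound)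
qed

subsection \<open>Binary forms\<close>

lemma Cst_add: "Cst (a + b) = Cst a + Cst b"
  and Cst_mult: "Cst (a * b) = Cst a * Cst b"
  and Cst_0: "Cst 0 = 0"
  and Cst_1: "Cst 1 = 1"
  and Cst_minus: "Cst (- a) = - Cst a"
  by (simp_all add: Cst_def one_pCons)

lemma Cst_power: "Cst (a ^ n) = Cst a ^ n"
  by (induction n) (simp_all add: Cst_1 Cst_mult)

lemma Cst_of_nat: "Cst (of_nat n) = of_nat n"
  by (induction n) (simp_all add: Cst_0 Cst_1 Cst_add)

lemma bcoeff_0 [simp]: "bcoeff 0 i j = 0"
  and bcoeff_add: "bcoeff (p + q) i j = bcoeff p i j + bcoeff q i j"
  and bcoeff_Cst_mult: "bcoeff (Cst c * p) i j = c * bcoeff p i j"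
  by (simp_all add: bcoeff_def Cst_def)

lemma bcoeff_sum: "bcoeff (sum f A) i j = (\<Sum>x\<in>A. bcoeff (f x) i j)"
  by (induction A rule: infinite_finite_induct) (simp_all add: bcoeff_add)

lemma bcoeff_monomial: "bcoeff (Z0 ^ a * Z1 ^ b) i j = (if i = a \<and> j = b then 1 else 0)"
proof -
  have "Z0 ^ a = [:monom 1 a:]"
    unfolding Z0_def by (induction a) (simp_all add: monom_Suc monom_0 one_pCons)
  moreover have "Z1 ^ b = monom 1 b"
    unfolding Z1_def by (induction b) (simp_all add: monom_Suc monom_0)
  ultimately show ?thesis by (auto simp: bcoeff_def)
qed

text \<open>In these forms only even powers occur and their coefficients are explicit, so the norm
  is a single sum; \<open>w_form\<close> is a rotated copy of one of them.\<close>

definition square_form :: "complex \<Rightarrow> complex \<Rightarrow> nat \<Rightarrow> complex poly poly" where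
  "square_form a b l = (Cst a * Z0\<^sup>2 + Cst b * Z1\<^sup>2) ^ l"

text \<open>Stated for arbitrary X and Y to serve twice: with the variables themselves for reading
  off coefficients, and with linear forms for the action.\<close>

lemma square_sum_power:
  "(Cst a * X\<^sup>2 + Cst b * Y\<^sup>2) ^ l =
     (\<Sum>j\<le>l. Cst (of_nat (l choose j) * a ^ (l - j) * b ^ j) * X ^ (2 * (l - j)) * Y ^ (2 * j))"
  unfolding add.commute[of "Cst a * X\<^sup>2"] binomial_ring
  by (intro sum.cong)
    (simp_all add: power_mult_distrib Cst_mult Cst_power Cst_of_nat mult_ac flip: power_mult)

lemma bcoeff_square_form:
  "bcoeff (square_form a b l) i k =
     (if even k \<and> i + k = 2 * l
      then of_nat (l choose (k div 2)) * a ^ (l - k div 2) * b ^ (k div 2) else 0)"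
proof -
  let ?c = "\<lambda>j. of_nat (l choose j) * a ^ (l - j) * b ^ j"
  have "bcoeff (square_form a b l) i k =
      (\<Sum>j\<le>l. ?c j * (if i = 2 * (l - j) \<and> k = 2 * j then 1 else 0))"
    by (simp add: square_form_def square_sum_power bcoeff_sum mult.assoc bcoeff_Cst_mult bcoeff_monomial)
  also have "\<dots> = (\<Sum>j\<le>l. if j = k div 2 then (if even k \<and> i + k = 2 * l then ?c j else 0) else 0)"
    by (intro sum.cong) auto
  also have "\<dots> = (if even k \<and> i + k = 2 * l then ?c (k div 2) else 0)"
    by (subst sum.delta) auto
  finally show ?thesis .
qed

lemma square_form_Sym: "square_form a b l \<in> Sym (2 * l)"
  by (simp add: Sym_def bcoeff_square_form)

lemma sum_even_indices:
  fixes f :: "nat \<Rightarrow> 'a :: comm_monoid_add"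
  shows "(\<Sum>k\<le>2 * l. if even k then f (k div 2) else 0) = (\<Sum>j\<le>l. f j)"
  by (induction l) simp_all

text \<open>The action is defined monomial by monomial; the binomial expansion read backwards resums
  it to a power of the substituted quadratic form.\<close>

lemma sym_action_square_form:
  "sym_action (2 * l) A (square_form a b l) =
     (Cst a * (Cst (A $$ (0, 0)) * Z0 + Cst (A $$ (1, 0)) * Z1)\<^sup>2 +
      Cst b * (Cst (A $$ (0, 1)) * Z0 + Cst (A $$ (1, 1)) * Z1)\<^sup>2) ^ l"
proof -
  define X where "X = Cst (A $$ (0, 0)) * Z0 + Cst (A $$ (1, 0)) * Z1"
  define Y where "Y = Cst (A $$ (0, 1)) * Z0 + Cst (A $$ (1, 1)) * Z1"
  let ?c = "\<lambda>j. Cst (of_nat (l choose j) * a ^ (l - j) * b ^ j) * X ^ (2 * (l - j)) * Y ^ (2 * j)"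
  have "sym_action (2 * l) A (square_form a b l) = (\<Sum>k\<le>2 * l. if even k then ?c (k div 2) else 0)"
    unfolding sym_action_def X_def[symmetric] Y_def[symmetric]
    by (intro sum.cong) (auto simp: bcoeff_square_form Cst_0 right_diff_distrib' elim!: evenE)
  also have "\<dots> = (Cst a * X\<^sup>2 + Cst b * Y\<^sup>2) ^ l"
    by (simp only: sum_even_indices[of ?c] square_sum_power)
  finally show ?thesis by (simp only: X_def Y_def)
qed

lemma sym_inner_square_form:
  "sym_inner (2 * l) (square_form (of_real a) (of_real b) l) (square_form (of_real a) (of_real b) l) =
     of_real (\<Sum>j\<le>l. (real (l choose j) * a ^ (l - j) * b ^ j)\<^sup>2 / real (2 * l choose (2 * j)))"
proof -
  let ?c = "\<lambda>j. complex_of_real ((real (l choose j) * a ^ (l - j) * b ^ j)\<^sup>2 / real (2 * l choose (2 * j)))"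
  have "sym_inner (2 * l) (square_form (of_real a) (of_real b) l) (square_form (of_real a) (of_real b) l) =
      (\<Sum>k\<le>2 * l. if even k then ?c (k div 2) else 0)"
    unfolding sym_inner_def
    by (intro sum.cong) (auto simp: bcoeff_square_form power2_eq_square elim!: evenE)
  also have "\<dots> = (\<Sum>j\<le>l. ?c j)" by (rule sum_even_indices)
  finally show ?thesis by (simp only: of_real_sum)
qed

text \<open>With m = l - j both sides equal (2j)! (2m)! (l!)^2 / ((j!)^2 (m!)^2 (2l)!). This turns
  the weights of the invariant norm into central binomial coefficients.\<close>

lemma binomial_square_quotient:
  assumes "j \<le> l"
  shows "real (l choose j) ^ 2 / real (2 * l choose (2 * j)) =
    real (2 * j choose j) * real (2 * (l - j) choose (l - j)) / real (2 * l choose l)"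
proof -
  define m where "m = l - j"
  have l: "l = j + m" using assms by (simp add: m_def)
  have f: "(fact n :: real) \<noteq> 0" for n by simp
  show ?thesis
    unfolding m_def[symmetric] l
    by (simp add: binomial_fact mult_2 power2_eq_square) (simp add: field_simps)
qed

lemma sym_inner_Cst:
  "sym_inner n (Cst a * p) (Cst b * q) = cnj a * b * sym_inner n p q"
  unfolding sym_inner_def bcoeff_Cst_mult sum_distrib_left by (simp add: mult_ac)

lemma sym_inner_Z0_power_right: "sym_inner n p (Z0 ^ n) = cnj (bcoeff p n 0)"
proof -
  have "sym_inner n p (Z0 ^ n) = (\<Sum>k\<le>n. if k = 0 then cnj (bcoeff p n 0) else 0)"
    unfolding sym_inner_def using bcoeff_monomial[of n 0]
    by (intro sum.cong) auto
  thus ?thesis by simp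
qed

lemma sym_inner_sym_hat:
  "sym_inner n (sym_hat n p) (sym_hat n q) = sym_inner n p q / of_real (sym_norm n p * sym_norm n q)"
  by (simp add: sym_hat_def sym_inner_Cst)

text \<open>Shows that the \<open>Re\<close> in \<open>sym_norm\<close> loses nothing.\<close>

lemma sym_inner_self_real: "sym_inner n p p = of_real (\<Sum>k\<le>n. (cmod (bcoeff p (n - k) k))\<^sup>2 / real (n choose k))"
  unfolding sym_inner_def of_real_sum
  by (intro sum.cong) (simp_all add: mult.commute flip: complex_norm_square)

lemma sym_hat_self:
  assumes "sym_inner n p p \<noteq> 0"
  shows "sym_inner n (sym_hat n p) (sym_hat n p) = 1"
proof -
  define R where "R = (\<Sum>k\<le>n. (cmod (bcoeff p (n - k) k))\<^sup>2 / real (n choose k))"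
  have "R \<ge> 0" unfolding R_def by (intro sum_nonneg) auto
  moreover have "sym_inner n p p = of_real R" unfolding R_def by (rule sym_inner_self_real)
  ultimately show ?thesis using assms
    by (simp add: sym_inner_sym_hat sym_norm_def flip: of_real_mult)
qed

lemma Cst_mult_Sym: "p \<in> Sym n \<Longrightarrow> Cst c * p \<in> Sym n"
  by (simp add: Sym_def bcoeff_Cst_mult)

lemma Z0_power_Sym: "Z0 ^ n \<in> Sym n"
  using bcoeff_monomial[of n 0] by (auto simp: Sym_def)

subsection \<open>Rotations and unitary representations\<close>

lemma eq_mat_3I:
  assumes "A \<in> carrier_mat 3 3" "B \<in> carrier_mat 3 3"
    and "\<And>i j. i \<in> {0, 1, 2} \<Longrightarrow> j \<in> {0, 1, 2} \<Longrightarrow> A $$ (i, j) = B $$ (i, j)"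
  shows "A = B"
proof (rule eq_matI)
  fix i j assume "i < dim_row B" "j < dim_col B"
  hence "i \<in> {0, 1, 2}" "j \<in> {0, 1, 2}" using assms(2) by auto
  thus "A $$ (i, j) = B $$ (i, j)" by (rule assms(3))
qed (use assms in auto)

lemma mat_exp_E2:
  "mat_exp (c \<cdot>\<^sub>m E2) = mat_of_rows_list 3 [[cos c, 0, sin c], [0, 1, 0], [- sin c, 0, cos c]]"
proof -
  \<comment> \<open>The degree m Taylor term of the rotation matrix. The middle entry contributes
    only for m = 0, since \<open>E2\<close> annihilates the second basis vector.\<close>
  define M where "M m = mat_of_rows_list 3
      [[cos_coeff m * c ^ m, 0, sin_coeff m * c ^ m], [0, if m = 0 then 1 else 0, 0],
       [- (sin_coeff m * c ^ m), 0, cos_coeff m * c ^ m]]" for m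
  have carr: "M m \<in> carrier_mat 3 3" "E2 \<in> carrier_mat 3 3" for m
    by (auto simp: M_def E2_def mat_of_rows_list_def)
  have pow: "(c \<cdot>\<^sub>m E2) ^\<^sub>m m = fact m \<cdot>\<^sub>m M m" for m
  proof (induction m)
    case 0
    show ?case
      by (rule eq_mat_3I) (use carr in \<open>auto simp: M_def mat_of_rows_list_def E2_def\<close>)
  next
    case (Suc m)
    have "(fact m \<cdot>\<^sub>m M m) * (c \<cdot>\<^sub>m E2) = fact (Suc m) \<cdot>\<^sub>m M (Suc m)"
    proof (rule eq_mat_3I)
      fix i j :: nat assume "i \<in> {0, 1, 2}" "j \<in> {0, 1, 2}"
      \<comment> \<open>The derivative rules of sine and cosine on the level of coefficients;
        multiplication by \<open>E2\<close> exchanges the two kinds of entries with matching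
        signs.\<close>
      moreover have "fact (Suc m) * sin_coeff (Suc m) = fact m * cos_coeff m"
          "fact (Suc m) * cos_coeff (Suc m) = - (fact m * sin_coeff m)"
        by (simp_all add: sin_coeff_Suc cos_coeff_Suc)
      hence "fact (Suc m) * (sin_coeff (Suc m) * c ^ Suc m) = fact m * cos_coeff m * c ^ Suc m"
          "fact (Suc m) * (cos_coeff (Suc m) * c ^ Suc m) = - (fact m * sin_coeff m * c ^ Suc m)"
        by (simp_all only: mult.assoc[symmetric] minus_mult_left)
      ultimately show "((fact m \<cdot>\<^sub>m M m) * (c \<cdot>\<^sub>m E2)) $$ (i, j) = (fact (Suc m) \<cdot>\<^sub>m M (Suc m)) $$ (i, j)"
        by (auto simp: M_def E2_def mat_of_rows_list_def scalar_prod_def numeral_3_eq_3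
          simp del: fact_Suc power_Suc)
    qed (use carr in \<open>auto intro!: mult_carrier_mat[of _ 3 3] simp del: fact_Suc\<close>)
    thus ?case by (simp only: pow_mat.simps Suc.IH)
  qed
  have s: "(\<Sum>m. cos_coeff m * c ^ m) = cos c" "(\<Sum>m. sin_coeff m * c ^ m) = sin c"
      "(\<Sum>m. - (sin_coeff m * c ^ m)) = - sin c"
    using cos_converges[of c] sin_converges[of c] sums_minus[OF sin_converges[of c]]
    by (auto simp: sums_iff)
  have s1: "(\<Sum>m. if m = 0 then 1 else 0 :: real) = 1"
    using sums_single[of 0 "\<lambda>_. 1 :: real"] by (simp add: sums_iff)
  show ?thesis
    unfolding mat_exp_def pow
    by (rule eq_mat_3I) (auto simp: M_def E2_def mat_of_rows_list_def s s1)
qed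

lemma g_rot_period: "g_rot (2 * pi * of_int k) = 1\<^sub>m 3"
proof -
  have "sin (2 * pi * of_int k) = 0" "cos (2 * pi * of_int k) = 1"
    using sin_int_2pin[of k] cos_int_2pin[of k] by simp_all
  thus ?thesis unfolding g_rot_def mat_exp_E2
    by (intro eq_mat_3I) (auto simp: mat_of_rows_list_def)
qed

section \<open>Unitary matrices and the contragredient\<close>

lemma hinner_sum: "hinner x y = (\<Sum>i<dim_vec x. cnj (x $ i) * y $ i)"
  by (simp add: hinner_def scalar_prod_def mult.commute atLeast0LessThan)

lemma mat_adjoint_conv: "mat_adjoint A = transpose_mat (map_mat cnj A)"
  by (rule eq_matI) (auto simp: mat_adjoint_def mat_of_rows_def)

lemma hinner_unitary:
  assumes T: "T \<in> carrier_mat n n" "mat_adjoint T * T = 1\<^sub>m n"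
    and x: "x \<in> carrier_vec n" and y: "y \<in> carrier_vec n"
  shows "hinner (T *\<^sub>v x) (T *\<^sub>v y) = hinner x y"
proof -
  have c: "conjugate (T *\<^sub>v x) = map_mat cnj T *\<^sub>v conjugate x"
    using T(1) x by (intro eq_vecI) (auto simp: scalar_prod_def)
  have "(T *\<^sub>v y) \<bullet> (map_mat cnj T *\<^sub>v conjugate x) = (mat_adjoint T *\<^sub>v (T *\<^sub>v y)) \<bullet> conjugate x"
    unfolding mat_adjoint_conv
    by (rule transpose_vec_mult_scalar[of _ n n, symmetric]) (use T(1) x y in auto)
  also have "mat_adjoint T *\<^sub>v (T *\<^sub>v y) = y"
    using T y by (subst assoc_mult_mat_vec[symmetric, of _ n n _ n]) (auto simp: mat_adjoint_conv)
  finally show ?thesis by (simp add: hinner_def c)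
qed

lemma SO3_transpose: "g \<in> SO3 \<Longrightarrow> transpose_mat g \<in> SO3"
  using mat_mult_left_right_inverse[of "transpose_mat g" 3 g] by (auto simp: SO3_def det_transpose)

text \<open>For the unitary matrix R the identity R R* = 1, transposed, says that conj(R) is a left
  inverse of the transpose of R, and conj(R) is the adjoint of that transpose.\<close>

lemma contragredient_unitary:
  assumes "unitary_rep_SO3 n \<pi>" "g \<in> SO3"
  shows "contragredient \<pi> g \<in> carrier_mat n n"
    and "mat_adjoint (contragredient \<pi> g) * contragredient \<pi> g = 1\<^sub>m n"
proof -
  define R where "R = \<pi> (transpose_mat g)"
  have R: "R \<in> carrier_mat n n" "mat_adjoint R * R = 1\<^sub>m n"
    using assms SO3_transpose[OF assms(2)] by (auto simp: unitary_rep_SO3_def R_def)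
  have "R * mat_adjoint R = 1\<^sub>m n"
    using R by (intro mat_mult_left_right_inverse[OF _ _ R(2)]) (simp_all add: mat_adjoint_conv)
  hence "transpose_mat (R * mat_adjoint R) = 1\<^sub>m n" by simp
  thus "mat_adjoint (contragredient \<pi> g) * contragredient \<pi> g = 1\<^sub>m n"
    using R(1) by (subst (asm) transpose_mult[of _ n n])
      (auto simp: mat_adjoint_conv contragredient_def map_mat_transpose R_def)
  show "contragredient \<pi> g \<in> carrier_mat n n"
    using R(1) by (simp add: contragredient_def R_def)
qed

text \<open>The image of the identity is idempotent by multiplicativity and has its adjoint as left
  inverse; cancelling one factor leaves the identity matrix.\<close>

lemma contragredient_one:
  assumes "unitary_rep_SO3 n \<pi>"
  shows "contragredient \<pi> (1\<^sub>m 3) = 1\<^sub>m n"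
proof -
  define P where "P = \<pi> (1\<^sub>m 3)"
  have one: "(1\<^sub>m 3 :: real mat) \<in> SO3" by (simp add: SO3_def)
  have P: "P \<in> carrier_mat n n" "mat_adjoint P * P = 1\<^sub>m n"
    using assms one by (auto simp: unitary_rep_SO3_def P_def)
  have "\<pi> (1\<^sub>m 3 * 1\<^sub>m 3) = P * P"
    using assms one unfolding unitary_rep_SO3_def P_def by blast
  hence "P * P = P" by (simp add: P_def)
  have "P = mat_adjoint P * P * P" using P by simp
  also have "\<dots> = mat_adjoint P * (P * P)"
    using P by (intro assoc_mult_mat[of _ n n _ n _ n]) (auto simp: mat_adjoint_conv)
  also have "\<dots> = 1\<^sub>m n" using P \<open>P * P = P\<close> by simp
  finally show ?thesis by (simp add: contragredient_def P_def)
qed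

section \<open>Transport between the dual space and binary forms\<close>

lemma to_dual:
  assumes "equivariant_unitary_identification \<kappa> l \<pi> \<Phi>" "p \<in> Sym (2 * l)"
  shows "to_dual l \<Phi> p \<in> carrier_vec (2 * l + 1)" "\<Phi> (to_dual l \<Phi> p) = p"
proof -
  have b: "inj_on \<Phi> (carrier_vec (2 * l + 1))" "p \<in> \<Phi> ` carrier_vec (2 * l + 1)"
    using assms by (auto simp: equivariant_unitary_identification_def bij_betw_def)
  show "to_dual l \<Phi> p \<in> carrier_vec (2 * l + 1)"
    unfolding to_dual_def by (rule the_inv_into_into[OF b]) simp
  show "\<Phi> (to_dual l \<Phi> p) = p"
    unfolding to_dual_def by (rule f_the_inv_into_f[OF b])
qed

lemma hinner_to_dual:
  assumes "equivariant_unitary_identification \<kappa> l \<pi> \<Phi>" "p \<in> Sym (2 * l)" "q \<in> Sym (2 * l)"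
  shows "hinner (to_dual l \<Phi> p) (to_dual l \<Phi> q) = sym_inner (2 * l) p q"
  using assms(1) to_dual[OF assms(1,2)] to_dual[OF assms(1,3)]
  unfolding equivariant_unitary_identification_def by metis

text \<open>Invariance of the inner product on forms is read off from the identification with a unitary
  representation, which spares a direct computation.\<close>

lemma sym_action_unitary:
  assumes \<Phi>: "equivariant_unitary_identification \<kappa> l \<pi> \<Phi>"
    and "unitary_rep_SO3 (2 * l + 1) \<pi>" "double_cover \<kappa>" "A \<in> SU2"
    and p: "p \<in> Sym (2 * l)"
  shows "sym_action (2 * l) A p \<in> Sym (2 * l)"
    and "sym_inner (2 * l) (sym_action (2 * l) A p) (sym_action (2 * l) A p) = sym_inner (2 * l) p p"
proof -
  define x where "x = to_dual l \<Phi> p"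
  define T where "T = contragredient \<pi> (\<kappa> A)"
  note x = to_dual[OF \<Phi> p, folded x_def]
  have "\<kappa> A \<in> SO3" using assms by (auto simp: double_cover_def)
  note T = contragredient_unitary[OF assms(2) this, folded T_def]
  have Tx: "T *\<^sub>v x \<in> carrier_vec (2 * l + 1)" using T x by simp
  have act: "sym_action (2 * l) A p = \<Phi> (T *\<^sub>v x)"
    using \<Phi> \<open>A \<in> SU2\<close> x unfolding equivariant_unitary_identification_def T_def by metis
  have \<Phi>_inner: "sym_inner (2 * l) (\<Phi> y) (\<Phi> y) = hinner y y"
    if "y \<in> carrier_vec (2 * l + 1)" for y
    using \<Phi> that by (auto simp: equivariant_unitary_identification_def)
  show "sym_action (2 * l) A p \<in> Sym (2 * l)"
    using \<Phi> Tx unfolding act equivariant_unitary_identification_def bij_betw_def by blast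
  have "sym_inner (2 * l) (\<Phi> (T *\<^sub>v x)) (\<Phi> (T *\<^sub>v x)) = hinner x x"
    using hinner_unitary[OF T x(1) x(1)] by (simp only: \<Phi>_inner[OF Tx])
  also have "\<dots> = sym_inner (2 * l) p p"
    using \<Phi>_inner[OF x(1)] x(2) by simp
  finally show "sym_inner (2 * l) (sym_action (2 * l) A p) (sym_action (2 * l) A p) = sym_inner (2 * l) p p"
    by (simp only: act)
qed

subsection \<open>The norm of the second vector\<close>

text \<open>Its columns are the normalised eigenvectors (1,1) and (-1,1) of the quadratic form z0^2
  + z1^2 + 2D z0 z1, whose eigenvalues are 1 + D and 1 - D.\<close>

definition rotation45 :: "complex mat" where
  "rotation45 = (let s = complex_of_real (1 / sqrt 2) in mat_of_rows_list 2 [[s, - s], [s, s]])"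

lemma half_sqrt_square: "complex_of_real (1 / sqrt 2) * complex_of_real (1 / sqrt 2) = 1 / 2"
  by (simp flip: of_real_mult)

lemma rotation45_SU2: "rotation45 \<in> SU2"
proof -
  define s where "s = complex_of_real (1 / sqrt 2)"
  have R: "rotation45 = mat_of_rows_list 2 [[s, - s], [s, s]]"
    by (simp add: rotation45_def s_def Let_def)
  have s: "s * s = 1 / 2" "cnj s = s"
    using half_sqrt_square by (simp_all add: s_def)
  have carr: "rotation45 \<in> carrier_mat 2 2" by (auto simp: R mat_of_rows_list_def)
  have ev: "rotation45 $$ (0, 0) = s" "rotation45 $$ (0, 1) = - s" "rotation45 $$ (1, 0) = s"
      "rotation45 $$ (1, 1) = s"
    by (auto simp: R mat_of_rows_list_def)
  have "mat_adjoint rotation45 * rotation45 = 1\<^sub>m 2"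
  proof (rule eq_matI)
    fix i j assume "i < dim_row (1\<^sub>m 2 :: complex mat)" "j < dim_col (1\<^sub>m 2 :: complex mat)"
    hence "i = 0 \<or> i = 1" "j = 0 \<or> j = 1" by auto
    thus "(mat_adjoint rotation45 * rotation45) $$ (i, j) = 1\<^sub>m 2 $$ (i, j)"
      using carr by (auto simp: mat_adjoint_conv scalar_prod_def numeral_2_eq_2 ev[unfolded One_nat_def] s)
  qed (use carr in \<open>auto simp: mat_adjoint_conv\<close>)
  moreover have "det rotation45 = 1"
  proof -
    have "det rotation45 = (\<Sum>j<2. rotation45 $$ (0, j) * cofactor rotation45 0 j)"
      by (rule laplace_expansion_row[OF carr]) simp
    also have "\<dots> = 1"
      using carr by (simp add: numeral_2_eq_2 cofactor_def det_single mat_delete_def ev[unfolded One_nat_def] s)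
    finally show ?thesis .
  qed
  ultimately show ?thesis using carr by (simp add: SU2_def)
qed

lemma w_form_rotation:
  "w_form l \<tau> = sym_action (2 * l) rotation45
     (square_form (of_real (1 + cosh \<tau> / sinh \<tau>)) (of_real (1 - cosh \<tau> / sinh \<tau>)) l)"
proof -
  define S where "S = Cst (complex_of_real (1 / sqrt 2))"
  define D where "D = Cst (complex_of_real (cosh \<tau> / sinh \<tau>))"
  have "S * S + S * S = 1"
    unfolding S_def by (simp only: half_sqrt_square flip: Cst_mult Cst_add) (simp add: Cst_1)
  have ev: "rotation45 $$ (0, 0) = of_real (1 / sqrt 2)" "rotation45 $$ (0, 1) = - of_real (1 / sqrt 2)"
      "rotation45 $$ (1, 0) = of_real (1 / sqrt 2)" "rotation45 $$ (1, 1) = of_real (1 / sqrt 2)"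
    by (auto simp: rotation45_def mat_of_rows_list_def Let_def)
  \<comment> \<open>Inserting the factor 2 S^2 = 1 makes the diagonalisation a polynomial identity
    in S, D and the variables.\<close>
  have "Z0\<^sup>2 + Z1\<^sup>2 + (D + D) * Z0 * Z1 = (S * S + S * S) * (Z0\<^sup>2 + Z1\<^sup>2 + (D + D) * Z0 * Z1)"
    using \<open>S * S + S * S = 1\<close> by simp
  also have "\<dots> = (1 + D) * (S * Z0 + S * Z1)\<^sup>2 + (1 - D) * (- S * Z0 + S * Z1)\<^sup>2"
    by (simp add: power2_eq_square algebra_simps)
  finally have *: "Z0\<^sup>2 + Z1\<^sup>2 + (D + D) * Z0 * Z1 =
      (1 + D) * (S * Z0 + S * Z1)\<^sup>2 + (1 - D) * (- S * Z0 + S * Z1)\<^sup>2" .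
  have D: "Cst (complex_of_real (2 * (cosh \<tau> / sinh \<tau>))) = D + D"
      "Cst (complex_of_real (1 + cosh \<tau> / sinh \<tau>)) = 1 + D"
      "Cst (complex_of_real (1 - cosh \<tau> / sinh \<tau>)) = 1 - D"
    unfolding D_def mult_2 of_real_add diff_conv_add_uminus of_real_minus Cst_add Cst_minus of_real_1 Cst_1
    by (rule refl)+
  show ?thesis
    unfolding w_form_def sym_action_square_form D ev Cst_minus S_def[symmetric] * by (rule refl)
qed

text \<open>The outer variable is z1, so the zeroth outer coefficient is evaluation at z1 = 0, which
  leaves z0^(2l).\<close>

lemma bcoeff_w_form: "bcoeff (w_form l \<tau>) (2 * l) 0 = 1"
proof -
  have "coeff (w_form l \<tau>) 0 = coeff (Z0 ^ (2 * l)) 0"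
    by (simp add: w_form_def poly_power Z1_def power_mult flip: poly_0_coeff_0)
  thus ?thesis using bcoeff_monomial[of "2 * l" 0 "2 * l" 0] by (simp add: bcoeff_def)
qed

section \<open>Closed form of the norm, overlaps and traces\<close>

lemma r_BF_sinh: "r_BF \<tau> = exp (- \<tau>) * sinh \<tau>"
  by (simp add: r_BF_def sinh_field_def field_simps flip: exp_add)

lemma r_BF_pos: "\<tau> > 0 \<Longrightarrow> r_BF \<tau> > 0"
  by (simp add: r_BF_def)

lemma sym_inner_square_form_coth:
  fixes l :: nat
  assumes "\<tau> > 0"
  defines "v \<equiv> square_form (of_real (1 + cosh \<tau> / sinh \<tau>)) (of_real (1 - cosh \<tau> / sinh \<tau>)) l"
  shows "sym_inner (2 * l) v v = of_real
    ((\<Sum>k\<le>l. cbin k * cbin (l - k) / cbin l * exp (- 4 * \<tau>) ^ k) / r_BF \<tau> ^ (2 * l))"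
proof -
  define a where "a = 1 + cosh \<tau> / sinh \<tau>"
  define b where "b = 1 - cosh \<tau> / sinh \<tau>"
  have sh: "sinh \<tau> > 0" using assms by simp
  have "a = (sinh \<tau> + cosh \<tau>) / sinh \<tau>" using sh by (simp add: a_def field_simps)
  hence "a = exp \<tau> / sinh \<tau>" by (simp only: sinh_plus_cosh)
  hence "a = 1 / r_BF \<tau>"
    by (simp add: r_BF_sinh exp_minus field_simps)
  hence a: "a\<^sup>2 = 1 / (r_BF \<tau>)\<^sup>2" by (simp add: power_divide)
  have "b = - ((cosh \<tau> - sinh \<tau>) / sinh \<tau>)" using sh by (simp add: b_def field_simps)
  hence "b = - (exp (- \<tau>) / sinh \<tau>)" by (simp only: cosh_minus_sinh)
  also have "\<dots> = - (exp (- \<tau>) * exp (- \<tau>) / r_BF \<tau>)"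
    by (simp add: r_BF_sinh)
  finally have "b\<^sup>2 = (exp (- \<tau>) * exp (- \<tau>))\<^sup>2 / (r_BF \<tau>)\<^sup>2"
    by (simp only: power2_minus power_divide)
  also have "(exp (- \<tau>) * exp (- \<tau>))\<^sup>2 = exp (- 4 * \<tau>)"
    by (simp add: power2_eq_square flip: exp_add)
  finally have b: "b\<^sup>2 = exp (- 4 * \<tau>) / (r_BF \<tau>)\<^sup>2" .
  have "(real (l choose k) * a ^ (l - k) * b ^ k)\<^sup>2 / real (2 * l choose (2 * k)) =
      cbin k * cbin (l - k) / cbin l * exp (- 4 * \<tau>) ^ k / r_BF \<tau> ^ (2 * l)" if "k \<le> l" for k
  proof -
    \<comment> \<open>Splitting at k lets the powers of 4 inside the three \<open>cbin\<close>
      cancel and collects all powers of \<open>r_BF\<close> into one factor independent of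
      k.\<close>
    have 4: "(4 :: real) ^ l = 4 ^ k * 4 ^ (l - k)"
      and r: "(r_BF \<tau>)\<^sup>2 ^ l = (r_BF \<tau>)\<^sup>2 ^ k * (r_BF \<tau>)\<^sup>2 ^ (l - k)"
      using that by (simp_all only: le_add_diff_inverse flip: power_add)
    have "(real (l choose k) * a ^ (l - k) * b ^ k)\<^sup>2 / real (2 * l choose (2 * k)) =
        (real (l choose k) ^ 2 / real (2 * l choose (2 * k))) * ((a\<^sup>2) ^ (l - k) * (b\<^sup>2) ^ k)"
      by (simp add: power_mult_distrib mult.commute flip: power_mult)
    also have "(a\<^sup>2) ^ (l - k) * (b\<^sup>2) ^ k = exp (- 4 * \<tau>) ^ k / r_BF \<tau> ^ (2 * l)"
      unfolding a b power_mult r by (simp add: power_divide)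
    also have "real (l choose k) ^ 2 / real (2 * l choose (2 * k)) = cbin k * cbin (l - k) / cbin l"
      unfolding binomial_square_quotient[OF that] cbin_def 4 by simp
    finally show ?thesis by simp
  qed
  hence "(\<Sum>k\<le>l. (real (l choose k) * a ^ (l - k) * b ^ k)\<^sup>2 / real (2 * l choose (2 * k))) =
      (\<Sum>k\<le>l. cbin k * cbin (l - k) / cbin l * exp (- 4 * \<tau>) ^ k / r_BF \<tau> ^ (2 * l))"
    by (intro sum.cong) auto
  thus ?thesis
    unfolding v_def a_def[symmetric] b_def[symmetric] sym_inner_square_form
    by (simp only: sum_divide_distrib)
qed

text \<open>Pairing with z0^(2l) reads off the leading coefficient 1, and \<open>u_form\<close>
  already has norm 1, so only the normalisation of \<open>w_form\<close> remains.\<close>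

lemma overlap_eq_inverse_norm:
  assumes "sym_inner (2 * l) (w_form l \<tau>) (w_form l \<tau>) = of_real W" "W \<ge> 0"
  shows "overlap l \<tau> = 1 / W"
proof -
  have "sym_inner (2 * l) (w_form l \<tau>) (u_form l) = 1"
    by (simp add: u_form_def sym_inner_Z0_power_right bcoeff_w_form)
  moreover have "sym_norm (2 * l) (u_form l) = 1"
    using bcoeff_monomial[of "2 * l" 0]
    by (simp add: sym_norm_def u_form_def sym_inner_Z0_power_right)
  moreover have "sym_norm (2 * l) (w_form l \<tau>) = sqrt W"
    using assms(1) by (simp add: sym_norm_def)
  ultimately show ?thesis
    using assms(2) by (simp add: overlap_def w_hat_def u_hat_def sym_inner_sym_hat norm_divide power_divide)
qed

text \<open>The double sum factors into the inner product times its conjugate. The middle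
  \<open>1\<^sub>m n\<close> stands where the group element sits in the traces.\<close>

lemma trace_line_projectors:
  assumes x: "x \<in> carrier_vec n" "hinner x x = 1" and y: "y \<in> carrier_vec n" "hinner y y = 1"
  shows "mat_trace (line_projector x * 1\<^sub>m n * line_projector y) = of_real ((cmod (hinner x y))\<^sup>2)"
proof -
  have d: "dim_vec x = n" "dim_vec y = n" using x y by auto
  have carr: "line_projector x \<in> carrier_mat n n" "line_projector y \<in> carrier_mat n n"
    by (auto simp: line_projector_def d)
  have cnj: "cnj (hinner x y) = (\<Sum>i<n. x $ i * cnj (y $ i))"
    by (simp add: hinner_sum d)
  have "mat_trace (line_projector x * 1\<^sub>m n * line_projector y) =
      (\<Sum>i<n. \<Sum>j<n. (x $ i * cnj (y $ i)) * (cnj (x $ j) * y $ j))"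
    using carr x(2) y(2)
    by (simp add: mat_trace_def scalar_prod_def line_projector_def d atLeast0LessThan mult_ac)
  also have "\<dots> = cnj (hinner x y) * hinner x y"
    by (simp only: cnj) (simp add: hinner_sum d sum_product)
  also have "\<dots> = of_real ((cmod (hinner x y))\<^sup>2)"
    by (simp only: complex_norm_square mult.commute)
  finally show ?thesis .
qed

text \<open>Comes from 2 sinh(2 \<tau>) exp(-2 \<tau>) = 1 - exp(-4 \<tau>); the value is the
  reciprocal of the limit in \<open>cbin_convolution_asymptotics\<close> at q = exp(-4
  \<tau>).\<close>

lemma C_BF_square:
  assumes "\<tau> > 0"
  shows "(C_BF \<tau>)\<^sup>2 = sqrt (1 - exp (- 4 * \<tau>))"
proof -
  have pos: "2 * sinh (2 * \<tau>) > 0" using assms by simp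
  have "exp (- \<tau> / 2) ^ 2 = exp (- \<tau>)"
    by (simp flip: exp_of_nat_mult)
  moreover have "sqrt (exp (- 2 * \<tau>)) = exp (- \<tau>)"
    by (rule real_sqrt_unique) (simp_all flip: exp_of_nat_mult)
  moreover have "((2 * sinh (2 * \<tau>)) powr (1 / 4)) ^ 2 = sqrt (2 * sinh (2 * \<tau>))"
    using pos by (simp add: powr_power powr_half_sqrt)
  ultimately have "(C_BF \<tau>)\<^sup>2 = sqrt (2 * sinh (2 * \<tau>)) * sqrt (exp (- 2 * \<tau>))"
    by (simp only: C_BF_def power_mult_distrib)
  also have "\<dots> = sqrt (1 - exp (- 4 * \<tau>))"
    by (simp add: sinh_def algebra_simps flip: real_sqrt_mult exp_add)
  finally show ?thesis .
qed

theorem theorem9p2: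
  fixes \<tau> t0 :: real and k :: int
    and \<kappa> :: "complex mat \<Rightarrow> real mat"
    and \<rho> :: "nat \<Rightarrow> real mat \<Rightarrow> complex mat"
    and \<Phi> :: "nat \<Rightarrow> complex vec \<Rightarrow> complex poly poly"
  assumes "\<tau> > 0"
    and "t0 = 2 * pi * of_int k"
    and "double_cover \<kappa>"
    and "\<And>l. unitary_rep_SO3 (2 * l + 1) (\<rho> l)"
    and "\<And>l. irreducible_rep_SO3 (2 * l + 1) (\<rho> l)"
    and "\<And>l. equivariant_unitary_identification \<kappa> l (\<rho> l) (\<Phi> l)"
  shows "(\<forall>l.
      hinner (to_dual l (\<Phi> l) (u_hat l))
        (contragredient (\<rho> l) (g_rot t0) *\<^sub>v to_dual l (\<Phi> l) (u_hat l)) = 1 \<and>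
      hinner (to_dual l (\<Phi> l) (w_hat l \<tau>))
        (contragredient (\<rho> l) (g_rot t0) *\<^sub>v to_dual l (\<Phi> l) (w_hat l \<tau>)) = 1 \<and>
      mat_trace (P_h l (\<Phi> l) * contragredient (\<rho> l) (g_rot t0) * P_tau l \<tau> (\<Phi> l))
        = complex_of_real (overlap l \<tau>) \<and>
      mat_trace (P_tau l \<tau> (\<Phi> l) * contragredient (\<rho> l) (g_rot t0) * P_h l (\<Phi> l))
        = complex_of_real (overlap l \<tau>)) \<and>
    (\<exists>e. e \<in> O(\<lambda>l. 1 / real l) \<and>
      (\<forall>l. overlap l \<tau> = (C_BF \<tau>)\<^sup>2 * r_BF \<tau> ^ (2 * l) * (1 + e l))) \<and>
    (\<lambda>l. r_BF \<tau> powi (- 2 * int l) * overlap l \<tau>) \<longlonglongrightarrow> (C_BF \<tau>)\<^sup>2"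
proof -
  define q where "q = exp (- 4 * \<tau>)"
  have q: "0 \<le> q" "q < 1" using assms(1) by (auto simp: q_def)
  define N where "N l = (\<Sum>k\<le>l. cbin k * cbin (l - k) / cbin l * q ^ k)" for l
  define c where "c = 1 / sqrt (1 - q)"
  have r: "r_BF \<tau> > 0" using assms(1) by (rule r_BF_pos)
  have c: "c > 0" "(C_BF \<tau>)\<^sup>2 = 1 / c" using q by (simp_all add: c_def C_BF_square[OF assms(1)] q_def)
  \<comment> \<open>The term k = 0 is 1 and the others are nonnegative. This keeps 1 /
    \<open>N l\<close> bounded uniformly in l.\<close>
  have N: "N l \<ge> 1" for l
  proof -
    have "(\<Sum>k\<in>{0}. cbin k * cbin (l - k) / cbin l * q ^ k) \<le> N l"
      unfolding N_def using q by (intro sum_mono2) (auto simp: less_imp_le[OF cbin_pos])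
    thus ?thesis using cbin_pos[of l] by simp
  qed
  \<comment> \<open>Invariance under the 45 degree rotation carries membership in \<open>Sym\<close>
    and the norm from square forms to \<open>w_form\<close>.\<close>
  note act = sym_action_unitary[OF assms(6,4,3) rotation45_SU2 square_form_Sym, folded w_form_rotation]
  have norm_w: "sym_inner (2 * l) (w_form l \<tau>) (w_form l \<tau>) = of_real (N l / r_BF \<tau> ^ (2 * l))" for l
    unfolding w_form_rotation using act(2) sym_inner_square_form_coth[OF assms(1)]
    by (simp only: w_form_rotation N_def q_def)
  have overlap: "overlap l \<tau> = r_BF \<tau> ^ (2 * l) / N l" for l
    using overlap_eq_inverse_norm[OF norm_w[of l]] N[of l] r by simp

  have level: "hinner (to_dual l (\<Phi> l) (u_hat l))
        (contragredient (\<rho> l) (g_rot t0) *\<^sub>v to_dual l (\<Phi> l) (u_hat l)) = 1 \<and>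
      hinner (to_dual l (\<Phi> l) (w_hat l \<tau>))
        (contragredient (\<rho> l) (g_rot t0) *\<^sub>v to_dual l (\<Phi> l) (w_hat l \<tau>)) = 1 \<and>
      mat_trace (P_h l (\<Phi> l) * contragredient (\<rho> l) (g_rot t0) * P_tau l \<tau> (\<Phi> l))
        = complex_of_real (overlap l \<tau>) \<and>
      mat_trace (P_tau l \<tau> (\<Phi> l) * contragredient (\<rho> l) (g_rot t0) * P_h l (\<Phi> l))
        = complex_of_real (overlap l \<tau>)" for l
  proof -
    define x where "x = to_dual l (\<Phi> l) (u_hat l)"
    define y where "y = to_dual l (\<Phi> l) (w_hat l \<tau>)"
    have g: "contragredient (\<rho> l) (g_rot t0) = 1\<^sub>m (2 * l + 1)"
      unfolding assms(2) g_rot_period by (rule contragredient_one[OF assms(4)])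
    have u: "u_hat l \<in> Sym (2 * l)"
      unfolding u_hat_def sym_hat_def u_form_def by (intro Cst_mult_Sym Z0_power_Sym)
    have w: "w_hat l \<tau> \<in> Sym (2 * l)"
      unfolding w_hat_def sym_hat_def using act(1) by (intro Cst_mult_Sym) (simp only: w_form_rotation)
    have "sym_inner (2 * l) (u_form l) (u_form l) = 1"
      using bcoeff_monomial[of "2 * l" 0 "2 * l" 0] by (simp add: u_form_def sym_inner_Z0_power_right)
    hence uu: "sym_inner (2 * l) (u_hat l) (u_hat l) = 1"
      unfolding u_hat_def by (intro sym_hat_self) simp
    have ww: "sym_inner (2 * l) (w_hat l \<tau>) (w_hat l \<tau>) = 1"
      unfolding w_hat_def using norm_w[of l] N[of l] r by (intro sym_hat_self) simp
    note h = hinner_to_dual[OF assms(6)]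
    have x: "x \<in> carrier_vec (2 * l + 1)" "hinner x x = 1"
      unfolding x_def using to_dual(1)[OF assms(6) u] h[OF u u] uu by simp_all
    have y: "y \<in> carrier_vec (2 * l + 1)" "hinner y y = 1"
      unfolding y_def using to_dual(1)[OF assms(6) w] h[OF w w] ww by simp_all
    have yx: "(cmod (hinner y x))\<^sup>2 = overlap l \<tau>"
      unfolding x_def y_def h[OF w u] overlap_def by (rule refl)
    \<comment> \<open>Conjugate symmetry gives both orders of the mixed trace the same
      modulus.\<close>
    have "hinner x y = cnj (hinner y x)"
      using x y by (simp add: hinner_sum mult.commute)
    hence xy: "(cmod (hinner x y))\<^sup>2 = overlap l \<tau>" using yx by simp
    show ?thesis
      unfolding g P_h_def P_tau_def x_def[symmetric] y_def[symmetric]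
        trace_line_projectors[OF x y] trace_line_projectors[OF y x] xy yx
      using x y by simp
  qed

  \<comment> \<open>Solves 1 / \<open>N l\<close> = (1 / c) (1 + \<open>e l\<close>), where 1 / c is
    the square of \<open>C_BF\<close>.\<close>
  define e where "e l = (c - N l) / N l" for l
  have "e \<in> O(\<lambda>l. N l - c)"
  proof (rule bigoI[of _ 1], rule always_eventually, rule allI)
    fix l
    have "\<bar>c - N l\<bar> / N l \<le> \<bar>c - N l\<bar> / 1" using N[of l] by (intro divide_left_mono) auto
    thus "norm (e l) \<le> 1 * norm (N l - c)" using N[of l] by (simp add: e_def abs_minus_commute)
  qed
  also have "(\<lambda>l. N l - c) \<in> O(\<lambda>l. 1 / real l)"
    unfolding N_def c_def using q by (rule cbin_convolution_asymptotics)
  finally have e: "e \<in> O(\<lambda>l. 1 / real l)" .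
  have overlap_e: "overlap l \<tau> = (C_BF \<tau>)\<^sup>2 * r_BF \<tau> ^ (2 * l) * (1 + e l)" for l
    using N[of l] c by (simp add: overlap e_def field_simps)
  have "(\<lambda>l. 1 / real l) \<in> o(\<lambda>_. 1)"
    by (rule smalloI_tendsto) (simp_all add: lim_1_over_n)
  with e have "e \<in> o(\<lambda>_. 1)" by (rule landau_o.big_small_trans)
  hence "e \<longlonglongrightarrow> 0" by (auto dest: smalloD_tendsto)
  hence "(\<lambda>l. (C_BF \<tau>)\<^sup>2 * (1 + e l)) \<longlonglongrightarrow> (C_BF \<tau>)\<^sup>2 * (1 + 0)" by (intro tendsto_intros)
  moreover have "r_BF \<tau> powi (- 2 * int l) * overlap l \<tau> = (C_BF \<tau>)\<^sup>2 * (1 + e l)" for l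
  proof -
    have "- 2 * int l = - int (2 * l)" by simp
    hence "r_BF \<tau> powi (- 2 * int l) = 1 / r_BF \<tau> ^ (2 * l)"
      by (simp only: power_int_minus power_int_of_nat inverse_eq_divide)
    thus ?thesis using r by (simp add: overlap_e)
  qed
  ultimately have "(\<lambda>l. r_BF \<tau> powi (- 2 * int l) * overlap l \<tau>) \<longlonglongrightarrow> (C_BF \<tau>)\<^sup>2" by simp
  with level e overlap_e show ?thesis by blast
qed

end
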